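(* Let $\varepsilon > 0$. Then for all sufficiently large integers $n$, \[ 2^{(1/4 - \varepsilon)n^2} \leqslant |\mathcal{R}'_n| \leqslant |\mathcal{R}_n| \leqslant 2^{(1/4 + \varepsilon)n^2}, \] where $\mathcal{R}_n$ is the set of all racks on the ground set $[n]=\{1,\dots,n\}$ and $\mathcal{R}'_n$ is the set of isomorphism classes of racks of order $n$.
   Context: A rack is a pair $(X,\triangleright)$ with $X$ a non-empty set and $\triangleright: X\times X\to X$ a binary operation such that (1) for all $y,z\in X$ there is $x\in X$ with $z = x\triangleright y$; (2) if $x\triangleright y = z\triangleright y$ then $x = z$; (3) $(x\triangleright y)\triangleright z = (x\triangleright z)\triangleright(y\triangleright z)$ for all $x,y,z\in X$. The order of a finite rack is $|X|$. A rack homomorphism $\phi:(X,\triangleright)\to(X',\triangleright')$ is a map with $(x\triangleright y)\phi = (x)\phi\triangleright'(y)\phi$; an isomorphism is a bijective homomorphism. *)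

theory Defs
  imports Complex_Main "HOL-Library.FuncSet"
begin

definition rack :: "'a set \<Rightarrow> ('a \<times> 'a \<Rightarrow> 'a) \<Rightarrow> bool" where
  "rack X t \<longleftrightarrow>
     X \<noteq> {} \<and> t \<in> X \<times> X \<rightarrow> X \<and>
     (\<forall>y\<in>X. \<forall>z\<in>X. \<exists>x\<in>X. z = t (x, y)) \<and>
     (\<forall>x\<in>X. \<forall>y\<in>X. \<forall>z\<in>X. t (x, y) = t (z, y) \<longrightarrow> x = z) \<and>
     (\<forall>x\<in>X. \<forall>y\<in>X. \<forall>z\<in>X. t (t (x, y), z) = t (t (x, z), t (y, z)))"

definition rack_hom :: "'a set \<Rightarrow> ('a \<times> 'a \<Rightarrow> 'a) \<Rightarrow> 'b set \<Rightarrow> ('b \<times> 'b \<Rightarrow> 'b) \<Rightarrow> ('a \<Rightarrow> 'b) \<Rightarrow> bool" where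
  "rack_hom X t X' t' \<phi> \<longleftrightarrow>
     \<phi> \<in> X \<rightarrow> X' \<and> (\<forall>x\<in>X. \<forall>y\<in>X. \<phi> (t (x, y)) = t' (\<phi> x, \<phi> y))"

definition rack_iso :: "'a set \<Rightarrow> ('a \<times> 'a \<Rightarrow> 'a) \<Rightarrow> 'b set \<Rightarrow> ('b \<times> 'b \<Rightarrow> 'b) \<Rightarrow> ('a \<Rightarrow> 'b) \<Rightarrow> bool" where
  "rack_iso X t X' t' \<phi> \<longleftrightarrow> rack_hom X t X' t' \<phi> \<and> bij_betw \<phi> X X'"

definition rack_isomorphic :: "'a set \<Rightarrow> ('a \<times> 'a \<Rightarrow> 'a) \<Rightarrow> 'b set \<Rightarrow> ('b \<times> 'b \<Rightarrow> 'b) \<Rightarrow> bool" where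
  "rack_isomorphic X t X' t' \<longleftrightarrow> (\<exists>\<phi>. rack_iso X t X' t' \<phi>)"

text \<open>The extensional function space makes each operation on \<open>{1..n}\<close> occur exactly once,
  so that \<open>card (racks n)\<close> is the number of racks with this ground set.\<close>

definition racks :: "nat \<Rightarrow> (nat \<times> nat \<Rightarrow> nat) set" where
  "racks n = {t \<in> {1..n} \<times> {1..n} \<rightarrow>\<^sub>E {1..n}. rack {1..n} t}"

definition racks_iso_rel :: "nat \<Rightarrow> ((nat \<times> nat \<Rightarrow> nat) \<times> (nat \<times> nat \<Rightarrow> nat)) set" where
  "racks_iso_rel n =
     {(s, t). s \<in> racks n \<and> t \<in> racks n \<and> rack_isomorphic {1..n} s {1..n} t}"

text \<open>Isomorphism classes of racks of order \<open>n\<close>, each cut down to its members with ground set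
  \<open>{1..n}\<close>. By \<open>rack_isomorphic_racks\<close> below, no class is lost.\<close>

definition rack_classes :: "nat \<Rightarrow> (nat \<times> nat \<Rightarrow> nat) set set" where
  "rack_classes n = racks n // racks_iso_rel n"

lemma finite_racks: "finite (racks n)"
  unfolding racks_def by (rule finite_subset[OF _ finite_PiE[of "{1..n} \<times> {1..n}" "\<lambda>_. {1..n}"]]) auto

lemma rack_isomorphic_refl: "rack_isomorphic X t X t"
proof -
  have "rack_iso X t X t id"
    by (simp add: rack_iso_def rack_hom_def)
  then show ?thesis unfolding rack_isomorphic_def by blast
qed

lemma rack_isomorphic_sym:
  assumes X: "rack X s" and st: "rack_isomorphic X s Y t"
  shows "rack_isomorphic Y t X s"
proof -
  obtain f where b: "bij_betw f X Y"
    and h: "\<And>x y. x \<in> X \<Longrightarrow> y \<in> X \<Longrightarrow> f (s (x, y)) = t (f x, f y)"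
    using st unfolding rack_isomorphic_def rack_iso_def rack_hom_def by blast
  define g where "g = the_inv_into X f"
  have bg: "bij_betw g Y X" unfolding g_def by (rule bij_betw_the_inv_into[OF b])
  have gX: "g y \<in> X" if "y \<in> Y" for y using bij_betwE[OF bg] that by blast
  have fg: "f (g y) = y" if "y \<in> Y" for y
    unfolding g_def by (rule f_the_inv_into_f_bij_betw[OF b]) (use that in simp)
  have gf: "g (f x) = x" if "x \<in> X" for x
    unfolding g_def by (rule the_inv_into_f_f[OF bij_betw_imp_inj_on[OF b] that])
  have sX: "s \<in> X \<times> X \<rightarrow> X" using X unfolding rack_def by (elim conjE)
  have "g (t (x, y)) = s (g x, g y)" if "x \<in> Y" "y \<in> Y" for x y
  proof -
    have "s (g x, g y) \<in> X" by (rule funcset_mem[OF sX]) (simp add: gX that)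
    from gf[OF this] show ?thesis by (simp add: h gX fg that)
  qed
  then have "rack_iso Y t X s g"
    unfolding rack_iso_def rack_hom_def using bg gX by blast
  then show ?thesis unfolding rack_isomorphic_def by blast
qed

lemma rack_isomorphic_trans:
  assumes "rack_isomorphic X r Y s" "rack_isomorphic Y s Z t"
  shows "rack_isomorphic X r Z t"
proof -
  obtain f where f: "bij_betw f X Y" "f \<in> X \<rightarrow> Y"
    "\<And>x y. x \<in> X \<Longrightarrow> y \<in> X \<Longrightarrow> f (r (x, y)) = s (f x, f y)"
    using assms(1) unfolding rack_isomorphic_def rack_iso_def rack_hom_def by blast
  obtain g where g: "bij_betw g Y Z" "g \<in> Y \<rightarrow> Z"
    "\<And>x y. x \<in> Y \<Longrightarrow> y \<in> Y \<Longrightarrow> g (s (x, y)) = t (g x, g y)"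
    using assms(2) unfolding rack_isomorphic_def rack_iso_def rack_hom_def by blast
  have "rack_iso X r Z t (g \<circ> f)"
    unfolding rack_iso_def rack_hom_def
  proof (intro conjI ballI)
    show "bij_betw (g \<circ> f) X Z" by (rule bij_betw_trans[OF f(1) g(1)])
    show "g \<circ> f \<in> X \<rightarrow> Z" using f(2) g(2) by auto
    fix x y assume "x \<in> X" "y \<in> X"
    then show "(g \<circ> f) (r (x, y)) = t ((g \<circ> f) x, (g \<circ> f) y)"
      using f(3)[of x y] g(3)[of "f x" "f y"] funcset_mem[OF f(2)] by simp
  qed
  then show ?thesis unfolding rack_isomorphic_def by blast
qed

lemma equiv_racks_iso_rel: "equiv (racks n) (racks_iso_rel n)"
proof (rule equivI)
  show "racks_iso_rel n \<subseteq> racks n \<times> racks n"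
    unfolding racks_iso_rel_def by blast
  show "refl_on (racks n) (racks_iso_rel n)"
    unfolding refl_on_def racks_iso_rel_def using rack_isomorphic_refl by blast
  show "sym (racks_iso_rel n)"
    unfolding sym_def racks_iso_rel_def racks_def using rack_isomorphic_sym by blast
  show "trans (racks_iso_rel n)"
    unfolding trans_def racks_iso_rel_def using rack_isomorphic_trans by blast
qed

lemma rack_isomorphic_racks:
  assumes "rack X t" "finite X" "card X = n"
  shows "\<exists>s\<in>racks n. rack_isomorphic X t {1..n} s"
proof -
  obtain f where b: "bij_betw f X {1..n}"
    using finite_same_card_bij[of X "{1..n}"] assms by auto
  define g where "g = the_inv_into X f"
  define s where "s = restrict (\<lambda>(x, y). f (t (g x, g y))) ({1..n} \<times> {1..n})"
  have gX: "g x \<in> X" "f (g x) = x" if "x \<in> {1..n}" for x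
    using that bij_betwE[OF bij_betw_the_inv_into[OF b]] f_the_inv_into_f_bij_betw[OF b]
    unfolding g_def by auto
  have fX: "f x \<in> {1..n}" "g (f x) = x" if "x \<in> X" for x
    using that bij_betwE[OF b] the_inv_into_f_f[of f X x] b
    unfolding g_def by (auto simp: bij_betw_def)
  have tX: "t (x, y) \<in> X" if "x \<in> X" "y \<in> X" for x y
    using assms(1) that by (auto simp: rack_def)
  have s: "s (x, y) = f (t (g x, g y))" if "x \<in> {1..n}" "y \<in> {1..n}" for x y
    using that by (simp add: s_def)
  have sP: "s (x, y) \<in> {1..n}" if "x \<in> {1..n}" "y \<in> {1..n}" for x y
    unfolding s[OF that] by (intro fX tX gX that)
  have sE: "s \<in> {1..n} \<times> {1..n} \<rightarrow>\<^sub>E {1..n}"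
    using sP by (auto simp: PiE_iff s_def)
  have 1: "\<exists>x\<in>{1..n}. z = s (x, y)" if y: "y \<in> {1..n}" and z: "z \<in> {1..n}" for y z
  proof -
    obtain x where x: "x \<in> X" "g z = t (x, g y)"
      using assms(1) gX(1)[OF y] gX(1)[OF z] unfolding rack_def by blast
    then have "z = s (f x, y)"
      using gX(2)[OF z] s[OF fX(1)[OF x(1)] y] fX(2)[OF x(1)] by metis
    then show ?thesis using fX(1)[OF x(1)] by blast
  qed
  have 2: "x = z"
    if x: "x \<in> {1..n}" and y: "y \<in> {1..n}" and z: "z \<in> {1..n}" and e: "s (x, y) = s (z, y)" for x y z
  proof -
    have "t (g x, g y) = t (g z, g y)"
      using e fX(2)[OF tX] gX(1) x y z by (metis s)
    then have "g x = g z"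
      using assms(1) gX(1)[OF x] gX(1)[OF y] gX(1)[OF z] unfolding rack_def by blast
    then show ?thesis using gX(2)[OF x] gX(2)[OF z] by metis
  qed
  have 3: "s (s (x, y), z) = s (s (x, z), s (y, z))"
    if x: "x \<in> {1..n}" and y: "y \<in> {1..n}" and z: "z \<in> {1..n}" for x y z
  proof -
    note G = gX(1)[OF x] gX(1)[OF y] gX(1)[OF z]
    have "t (t (g x, g y), g z) = t (t (g x, g z), t (g y, g z))"
      using assms(1) G unfolding rack_def by blast
    then show ?thesis
      using s[OF sP[OF x y] z] s[OF sP[OF x z] sP[OF y z]] s[OF x y] s[OF x z] s[OF y z]
        fX(2)[OF tX[OF G(1,2)]] fX(2)[OF tX[OF G(1,3)]] fX(2)[OF tX[OF G(2,3)]] by metis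
  qed
  have "X \<noteq> {}" using assms(1) by (simp add: rack_def)
  then have 0: "{1..n} \<noteq> {}" using fX(1) by blast
  have 4: "s \<in> {1..n} \<times> {1..n} \<rightarrow> {1..n}"
    using sE unfolding PiE_def by (rule IntD1)
  have "rack {1..n} s"
    unfolding rack_def
  proof (intro conjI ballI impI)
    show "{1..n} \<noteq> {}" by (rule 0)
    show "s \<in> {1..n} \<times> {1..n} \<rightarrow> {1..n}" by (rule 4)
    fix x y z assume xyz: "x \<in> {1..n}" "y \<in> {1..n}" "z \<in> {1..n}"
    show "s (s (x, y), z) = s (s (x, z), s (y, z))" by (rule 3[OF xyz])
    show "x = z" if "s (x, y) = s (z, y)" by (rule 2[OF xyz that])
  next
    fix y z assume "y \<in> {1..n}" "z \<in> {1..n}"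
    then show "\<exists>x\<in>{1..n}. z = s (x, y)" by (rule 1)
  qed
  moreover have "rack_iso X t {1..n} s f"
    unfolding rack_iso_def rack_hom_def
  proof (intro conjI ballI)
    show "f \<in> X \<rightarrow> {1..n}" using fX(1) by blast
    show "bij_betw f X {1..n}" by (rule b)
    show "f (t (x, y)) = s (f x, f y)" if "x \<in> X" "y \<in> X" for x y
      using s[OF fX(1)[OF that(1)] fX(1)[OF that(2)]] fX(2)[OF that(1)] fX(2)[OF that(2)] by metis
  qed
  ultimately show ?thesis
    using sE unfolding racks_def rack_isomorphic_def by blast
qed

end

theory Submission
  imports Defs "HOL-Real_Asymp.Real_Asymp"
begin

text \<open>
  Write \<open>f\<^sub>y\<close> for the column \<open>x \<mapsto> t (x, y)\<close>. The rack law says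
  that \<open>f\<^sub>z f\<^sub>y f\<^sub>z\<^sup>-\<^sup>1\<close> is the column of \<open>t (y, z)\<close>.

  Lower bound: split the ground set into pairs and let each \<open>f\<^sub>y\<close> swap some of the pairs,
  depending only on the pair of \<open>y\<close>. These permutations commute, so every bit matrix indexed by
  two pairs gives a rack, and an isomorphism class contains at most \<open>n\<^sup>n\<close> racks.

  Upper bound, with \<open>k\<close> about \<open>n\<^sup>1\<^sup>/\<^sup>4\<close>: knowing the columns in \<open>W\<close>, conjugation gives
  the columns of all elements connected to \<open>W\<close>, and all columns are known once one column per
  component of \<open>W\<close> is. Moreover \<open>f\<^sub>v\<close> is determined on a component of \<open>V \<subseteq> W\<close> by
  its value at one point, provided \<open>f\<^sub>v\<close> maps \<open>V\<close> to elements whose columns are known. If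
  \<open>f\<^sub>v\<close> preserves almost all components \<open>C\<close> of \<open>V\<close>, this leaves about
  \<open>\<Prod>\<^sub>C |C| \<le> 2\<^bsup>n - c(V)\<^esup>\<close> choices, where \<open>c\<close> counts components. As
  \<open>c(W) \<le> c(V)\<close>, one gets \<open>2\<^bsup>c(n - c)\<^esup> \<le> 2\<^bsup>n\<^sup>2/4\<^esup>\<close> up to lower order, for \<open>c = c(W)\<close>.

  To find the sets, take greedily \<open>k\<close> disjoint sets \<open>V\<^sub>i\<close> of size at most \<open>k\<^sup>2\<close> such that no
  further column merges \<open>k\<^sup>2\<close> components of \<open>V\<^sub>i\<close>, and extend their union greedily to a
  set \<open>W\<close> of size at most \<open>2k\<^sup>3\<close> such that no further column enlarges the set of
  elements connected to \<open>W\<close> by \<open>k\<close>. Then \<open>f\<^sub>v\<close> moves fewer than \<open>k\<close> elements of \<open>W\<close>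
  out of this set, hence none of the elements of some \<open>V\<^sub>i\<close>.
\<close>

section \<open>Columns, components and representatives\<close>

lemma rack_closed: "rack X t \<Longrightarrow> x \<in> X \<Longrightarrow> y \<in> X \<Longrightarrow> t (x, y) \<in> X"
  by (auto simp: rack_def)

lemma rack_surj: "rack X t \<Longrightarrow> y \<in> X \<Longrightarrow> z \<in> X \<Longrightarrow> \<exists>x\<in>X. z = t (x, y)"
  by (simp add: rack_def)

lemma rack_inj: "rack X t \<Longrightarrow> x \<in> X \<Longrightarrow> y \<in> X \<Longrightarrow> z \<in> X \<Longrightarrow> t (x, y) = t (z, y) \<Longrightarrow> x = z"
  unfolding rack_def by blast

lemma rack_dist:
  "rack X t \<Longrightarrow> x \<in> X \<Longrightarrow> y \<in> X \<Longrightarrow> z \<in> X \<Longrightarrow> t (t (x, y), z) = t (t (x, z), t (y, z))"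
  by (simp add: rack_def)

definition edges :: "'a set \<Rightarrow> ('a \<times> 'a \<Rightarrow> 'a) \<Rightarrow> 'a set \<Rightarrow> ('a \<times> 'a) set" where
  "edges X t U = {(x, t (x, u)) | x u. x \<in> X \<and> u \<in> U}"

text \<open>For a rack and \<open>U \<subseteq> X\<close>, the classes inside \<open>X\<close> are
  the orbits of the group generated by the columns of \<open>U\<close>. The closure lives on the
  whole type, so reflexivity needs no membership condition.\<close>

definition conn :: "'a set \<Rightarrow> ('a \<times> 'a \<Rightarrow> 'a) \<Rightarrow> 'a set \<Rightarrow> ('a \<times> 'a) set" where
  "conn X t U = (edges X t U \<union> (edges X t U)\<inverse>)\<^sup>*"

text \<open>Connected points give \<open>SOME\<close> the same predicate, so one point per component
  is picked and the image of \<open>X\<close> counts the components.\<close>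

definition rep :: "'a set \<Rightarrow> ('a \<times> 'a \<Rightarrow> 'a) \<Rightarrow> 'a set \<Rightarrow> 'a \<Rightarrow> 'a" where
  "rep X t U x = (SOME y. (x, y) \<in> conn X t U)"

definition reach :: "'a set \<Rightarrow> ('a \<times> 'a \<Rightarrow> 'a) \<Rightarrow> 'a set \<Rightarrow> 'a set" where
  "reach X t U = conn X t U `` U"

lemma conn_refl: "(x, x) \<in> conn X t U"
  by (simp add: conn_def)

lemma conn_sym: "(x, y) \<in> conn X t U \<Longrightarrow> (y, x) \<in> conn X t U"
  unfolding conn_def by (rule symD[OF sym_rtrancl]) (auto simp: sym_def)

lemma conn_trans: "(x, y) \<in> conn X t U \<Longrightarrow> (y, z) \<in> conn X t U \<Longrightarrow> (x, z) \<in> conn X t U"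
  unfolding conn_def by (rule rtrancl_trans)

lemma conn_edge: "x \<in> X \<Longrightarrow> u \<in> U \<Longrightarrow> (x, t (x, u)) \<in> conn X t U"
  unfolding conn_def edges_def by (rule r_into_rtrancl) blast

lemma conn_mono: "U \<subseteq> U' \<Longrightarrow> conn X t U \<subseteq> conn X t U'"
  unfolding conn_def edges_def by (rule rtrancl_mono) blast

lemma edges_cong:
  "(\<And>x u. x \<in> X \<Longrightarrow> u \<in> U \<Longrightarrow> t (x, u) = s (x, u)) \<Longrightarrow> edges X t U = edges X s U"
  unfolding edges_def by force

lemma conn_cong:
  "(\<And>x u. x \<in> X \<Longrightarrow> u \<in> U \<Longrightarrow> t (x, u) = s (x, u)) \<Longrightarrow> conn X t U = conn X s U"
  unfolding conn_def using edges_cong[of X U t s] by simp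

lemma rep_cong:
  "(\<And>x u. x \<in> X \<Longrightarrow> u \<in> U \<Longrightarrow> t (x, u) = s (x, u)) \<Longrightarrow> rep X t U = rep X s U"
  unfolding rep_def[abs_def] using conn_cong[of X U t s] by simp

lemma conn_induct [consumes 4, case_names refl forward backward]:
  assumes r: "rack X t" and U: "U \<subseteq> X" and x: "x \<in> X" and c: "(x, y) \<in> conn X t U"
    and "P x"
    and fwd: "\<And>y u. y \<in> X \<Longrightarrow> u \<in> U \<Longrightarrow> P y \<Longrightarrow> P (t (y, u))"
    and bwd: "\<And>y u. y \<in> X \<Longrightarrow> u \<in> U \<Longrightarrow> P (t (y, u)) \<Longrightarrow> P y"
  shows "P y \<and> y \<in> X"
  using c unfolding conn_def
proof (induction rule: rtrancl_induct)
  case base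
  show ?case using assms by simp
next
  case (step y z)
  then show ?case
    using fwd bwd rack_closed[OF r] U unfolding edges_def by blast
qed

lemma conn_closed:
  "rack X t \<Longrightarrow> U \<subseteq> X \<Longrightarrow> x \<in> X \<Longrightarrow> (x, y) \<in> conn X t U \<Longrightarrow> y \<in> X"
  using conn_induct[of X t U x y "\<lambda>_. True"] by simp

lemma rep_conn: "(x, rep X t U x) \<in> conn X t U"
  unfolding rep_def by (rule someI[of _ x]) (rule conn_refl)

lemma rep_eq_iff: "rep X t U x = rep X t U y \<longleftrightarrow> (x, y) \<in> conn X t U"
proof
  assume "rep X t U x = rep X t U y"
  then show "(x, y) \<in> conn X t U"
    by (metis rep_conn conn_sym conn_trans)
next
  assume "(x, y) \<in> conn X t U"
  then have "(x, z) \<in> conn X t U \<longleftrightarrow> (y, z) \<in> conn X t U" for z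
    by (meson conn_sym conn_trans)
  then show "rep X t U x = rep X t U y" by (simp add: rep_def)
qed

lemma rep_in: "rack X t \<Longrightarrow> U \<subseteq> X \<Longrightarrow> x \<in> X \<Longrightarrow> rep X t U x \<in> X"
  by (rule conn_closed[OF _ _ _ rep_conn])

lemma reach_mono: "U \<subseteq> U' \<Longrightarrow> reach X t U \<subseteq> reach X t U'"
  unfolding reach_def using conn_mono[of U U' X t] by blast

lemma reach_subset: "rack X t \<Longrightarrow> U \<subseteq> X \<Longrightarrow> reach X t U \<subseteq> X"
  unfolding reach_def using conn_closed[of X t U] by blast

section \<open>Recovering columns from partial data\<close>

text \<open>By the rack law the column of \<open>t (y, u)\<close> is the conjugate of the column of
  \<open>y\<close> by that of \<open>u\<close>. So agreement of columns spreads along the edges of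
  \<open>conn\<close>, in both directions.\<close>

lemma columns_agree:
  assumes r: "rack X t" "rack X s" and U: "U \<subseteq> X"
    and ag: "\<And>x u. x \<in> X \<Longrightarrow> u \<in> U \<Longrightarrow> t (x, u) = s (x, u)"
    and y: "y \<in> X" and c: "(y, z) \<in> conn X t U"
    and ay: "\<And>x. x \<in> X \<Longrightarrow> t (x, y) = s (x, y)"
    and x: "x \<in> X"
  shows "t (x, z) = s (x, z)"
proof -
  have "(\<forall>x\<in>X. t (x, z) = s (x, z)) \<and> z \<in> X"
    using r(1) U y c
  proof (induction rule: conn_induct)
    case refl
    then show ?case using ay by blast
  next
    case (forward y u)
    then have u: "u \<in> X" using U by blast
    show ?case
    proof
      fix x assume "x \<in> X"
      \<comment> \<open>Pulling \<open>x\<close> back through the column of \<open>u\<close>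
        realises the inverse in the conjugation.\<close>
      then obtain x' where x': "x' \<in> X" "x = t (x', u)" using rack_surj[OF r(1) u] by blast
      have "t (x, t (y, u)) = t (t (x', y), u)"
        using rack_dist[OF r(1) x'(1) \<open>y \<in> X\<close> u] x' by simp
      also have "\<dots> = s (s (x', y), u)"
        using forward x' ag rack_closed[OF r(2)] by simp
      also have "\<dots> = s (x, t (y, u))"
        using rack_dist[OF r(2) x'(1) \<open>y \<in> X\<close> u] x' ag forward by simp
      finally show "t (x, t (y, u)) = s (x, t (y, u))" .
    qed
  next
    case (backward y u)
    then have u: "u \<in> X" using U by blast
    show ?case
    proof
      fix x assume x: "x \<in> X"
      have "t (t (x, y), u) = t (t (x, u), t (y, u))" by (rule rack_dist[OF r(1) x \<open>y \<in> X\<close> u])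
      also have "\<dots> = s (s (x, u), s (y, u))"
        using backward rack_closed[OF r(1) x u] ag x by simp
      also have "\<dots> = s (s (x, y), u)" using rack_dist[OF r(2) x \<open>y \<in> X\<close> u] by simp
      also have "\<dots> = t (s (x, y), u)"
        using ag[OF rack_closed[OF r(2) x \<open>y \<in> X\<close>] \<open>u \<in> U\<close>] by simp
      finally show "t (x, y) = s (x, y)"
        using rack_inj[OF r(1) rack_closed[OF r(1) x \<open>y \<in> X\<close>] u rack_closed[OF r(2) x \<open>y \<in> X\<close>]]
        by simp
    qed
  qed
  then show ?thesis using x by blast
qed

text \<open>The rack law reads \<open>t (t (y, u), v) = t (t (y, v), t (u, v))\<close>: for
  \<open>u \<in> V\<close> the values at \<open>y\<close> and at \<open>t (y, u)\<close> determine
  each other through the column of \<open>t (u, v)\<close>, which is the same in \<open>s\<close>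
  because \<open>t (u, v)\<close> is in reach of \<open>W\<close>. Hence one value per component
  suffices. Two indices \<open>v\<close> and \<open>v'\<close> appear because later only columns are
  compared, not their positions.\<close>

lemma column_determined:
  assumes r: "rack X t" "rack X s" and V: "V \<subseteq> W" "W \<subseteq> X"
    and ag: "\<And>x u. x \<in> X \<Longrightarrow> u \<in> W \<Longrightarrow> t (x, u) = s (x, u)"
    and v: "v \<in> X" "v' \<in> X"
    and hr: "\<And>w. w \<in> V \<Longrightarrow> t (w, v) \<in> reach X t W"
    and eV: "\<And>w. w \<in> V \<Longrightarrow> t (w, v) = s (w, v')"
    and er: "\<And>x. x \<in> rep X t V ` X \<Longrightarrow> t (x, v) = s (x, v')"
    and x: "x \<in> X"
  shows "t (x, v) = s (x, v')"
proof -
  have VX: "V \<subseteq> X" using V by blast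
  have known: "t (y, t (w, v)) = s (y, t (w, v))" if w: "w \<in> V" and y: "y \<in> X" for w y
  proof -
    obtain w' where w': "w' \<in> W" "(w', t (w, v)) \<in> conn X t W"
      using hr[OF w] unfolding reach_def by blast
    have "w' \<in> X" using w' V by blast
    then show ?thesis
      using columns_agree[OF r V(2) ag _ w'(2) _ y] ag[OF _ w'(1)] by simp
  qed
  have "rep X t V x \<in> X" "(rep X t V x, x) \<in> conn X t V"
    using rep_in[OF r(1) VX x] conn_sym[OF rep_conn] by auto
  from r(1) VX this have "t (x, v) = s (x, v') \<and> x \<in> X"
  proof (induction rule: conn_induct)
    case refl
    then show ?case using er x by blast
  next
    case (forward y u)
    then have u: "u \<in> X" "u \<in> W" using V by auto
    have "t (t (y, u), v) = t (t (y, v), t (u, v))" by (rule rack_dist[OF r(1) \<open>y \<in> X\<close> u(1) v(1)])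
    also have "\<dots> = s (s (y, v'), s (u, v'))"
      using known[OF \<open>u \<in> V\<close> rack_closed[OF r(1) \<open>y \<in> X\<close> v(1)]] forward eV by simp
    also have "\<dots> = s (t (y, u), v')"
      using rack_dist[OF r(2) \<open>y \<in> X\<close> u(1) v(2)] ag[OF \<open>y \<in> X\<close> u(2)] by simp
    finally show ?case .
  next
    case (backward y u)
    then have u: "u \<in> X" "u \<in> W" using V by auto
    have "t (t (y, v), t (u, v)) = s (t (y, u), v')"
      using rack_dist[OF r(1) \<open>y \<in> X\<close> u(1) v(1)] backward by simp
    also have "\<dots> = s (s (y, v'), s (u, v'))"
      using rack_dist[OF r(2) \<open>y \<in> X\<close> u(1) v(2)] ag[OF \<open>y \<in> X\<close> u(2)] by simp
    also have "\<dots> = t (s (y, v'), t (u, v))"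
      using known[OF \<open>u \<in> V\<close> rack_closed[OF r(2) \<open>y \<in> X\<close> v(2)]] backward eV by simp
    finally show ?case
      using rack_inj[OF r(1) rack_closed[OF r(1) \<open>y \<in> X\<close> v(1)] rack_closed[OF r(1) u(1) v(1)]
          rack_closed[OF r(2) \<open>y \<in> X\<close> v(2)]] by simp
  qed
  then show ?thesis by simp
qed

section \<open>Greedy choice of the sets\<close>

text \<open>Take a largest \<open>W\<close> for which \<open>\<phi> W\<close> pays \<open>k\<close>
  units for each element added to \<open>B\<close>: an element raising \<open>\<phi>\<close> by
  \<open>k\<close> or more could still be added.\<close>

lemma greedy:
  fixes \<phi> :: "'a set \<Rightarrow> nat"
  assumes Y: "finite Y" and B: "finite B"
    and mono: "\<And>W. finite W \<Longrightarrow> B \<subseteq> W \<Longrightarrow> W \<subseteq> B \<union> Y \<Longrightarrow> \<phi> W \<le> N"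
    and k: "k > 0"
  shows "\<exists>W. B \<subseteq> W \<and> W \<subseteq> B \<union> Y \<and> (card W - card B) * k \<le> N \<and>
    (\<forall>v\<in>Y. \<phi> (insert v W) < \<phi> W + k)"
proof -
  define S where "S = {W. B \<subseteq> W \<and> W \<subseteq> B \<union> Y \<and> (card W - card B) * k \<le> \<phi> W}"
  have fin: "finite W" if "W \<in> S" for W
    using that Y B finite_subset[of W "B \<union> Y"] by (auto simp: S_def)
  have finS: "finite S"
    unfolding S_def by (rule finite_subset[of _ "Pow (B \<union> Y)"]) (use Y B in auto)
  have "B \<in> S" by (auto simp: S_def)
  then obtain W where W: "W \<in> S" "\<And>W'. W' \<in> S \<Longrightarrow> card W' \<le> card W"
    using finS Max_in[of "card ` S"] Max_ge[of "card ` S"] by (metis empty_iff finite_imageI image_eqI imageE)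
  have "\<phi> (insert v W) < \<phi> W + k" if v: "v \<in> Y" for v
  proof (rule ccontr)
    assume a: "\<not> ?thesis"
    show False
    proof (cases "v \<in> W")
      case True
      then show False using a k by (simp add: insert_absorb)
    next
      case False
      \<comment> \<open>Needed for the truncated subtraction in \<open>S\<close> to grow by one with
        \<open>W\<close>.\<close>
      have le: "card B \<le> card W" using W(1) fin[OF W(1)] by (auto simp: S_def card_mono)
      have "insert v W \<in> S"
        using W(1) v False a le fin[OF W(1)] by (auto simp: S_def Suc_diff_le)
      then have "card (insert v W) \<le> card W" by (rule W(2))
      then show False using False fin[OF W(1)] by simp
    qed
  qed
  moreover have "\<phi> W \<le> N" using mono[OF fin[OF W(1)]] W(1) by (auto simp: S_def)
  ultimately show ?thesis using W(1) by (intro exI[of _ W]) (auto simp: S_def)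
qed

text \<open>Let \<open>Q\<close> be a transversal of the fibres of \<open>h\<close>. Points of
  \<open>B\<close> outside \<open>Q\<close> lie in \<open>P - Q\<close>, and points of
  \<open>B\<close> inside \<open>Q\<close> are injected into \<open>P - Q\<close> by choosing a
  partner in the same fibre; hence the factor 2.\<close>

lemma card_nontrivial_fibres:
  assumes P: "finite P" and B: "B \<subseteq> P" "\<And>b. b \<in> B \<Longrightarrow> \<exists>p\<in>P. p \<noteq> b \<and> h p = h b"
  shows "card B \<le> 2 * (card P - card (h ` P))"
proof -
  obtain Q where Q: "Q \<subseteq> P" "inj_on h Q" "h ` Q = h ` P"
    using subset_image_inj[of "h ` P" h P] by auto
  have fQ: "finite Q" using Q(1) P finite_subset by blast
  have card: "card (P - Q) = card P - card (h ` P)"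
    using Q card_image[OF Q(2)] card_Diff_subset[OF fQ Q(1)] by simp
  obtain q where q: "\<And>b. b \<in> B \<Longrightarrow> q b \<in> P \<and> q b \<noteq> b \<and> h (q b) = h b" using B(2) by metis
  have "card (B \<inter> Q) \<le> card (P - Q)"
  proof (rule card_inj_on_le[of q])
    show "inj_on q (B \<inter> Q)"
      using q Q(2) by (intro inj_onI) (metis IntD1 IntD2 inj_onD)
    show "q ` (B \<inter> Q) \<subseteq> P - Q"
      using q Q(2) unfolding inj_on_def by fast
  qed (use P in auto)
  moreover have "card (B - Q) \<le> card (P - Q)"
    using B(1) P by (intro card_mono) auto
  moreover have "card B = card (B \<inter> Q) + card (B - Q)"
    using finite_subset[OF B(1) P] by (subst card_Un_disjoint[symmetric]) (auto simp: Int_Diff_Un)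
  ultimately show ?thesis using card by simp
qed

text \<open>Components of \<open>U'\<close> are unions of components of \<open>U\<close>, so the
  representatives of the latter meet each of the former.\<close>

lemma rep_image:
  assumes "rack X t" "U \<subseteq> X" "U \<subseteq> U'"
  shows "rep X t U' ` (rep X t U ` X) = rep X t U' ` X"
proof -
  have "rep X t U' (rep X t U x) = rep X t U' x" for x
    using conn_mono[OF assms(3), of X t] rep_conn[of x X t U] by (metis rep_eq_iff subsetD)
  then show ?thesis by (simp add: image_image)
qed

lemma card_rep_antimono:
  assumes "finite X" "rack X t" "U \<subseteq> X" "U \<subseteq> U'"
  shows "card (rep X t U' ` X) \<le> card (rep X t U ` X)"
  by (metis assms rep_image card_image_le finite_imageI)

text \<open>If the column of \<open>v\<close> moves \<open>x\<close> out of its component, adding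
  \<open>v\<close> to \<open>U\<close> merges this component with that of \<open>t (x, v)\<close>.
  Thus \<open>x\<close> lies in a nontrivial fibre of the coarser \<open>rep\<close> on the old
  representatives.\<close>

lemma card_moved_reps:
  assumes fin: "finite X" and r: "rack X t" and U: "U \<subseteq> X" and v: "v \<in> X"
  shows "card {x \<in> rep X t U ` X. (x, t (x, v)) \<notin> conn X t U}
    \<le> 2 * (card (rep X t U ` X) - card (rep X t (insert v U) ` X))"
proof -
  have "\<exists>p\<in>rep X t U ` X. p \<noteq> x \<and> rep X t (insert v U) p = rep X t (insert v U) x"
    if x: "x \<in> rep X t U ` X" "(x, t (x, v)) \<notin> conn X t U" for x
  proof -
    have xX: "x \<in> X" using x(1) rep_in[OF r U] by blast
    have "(x, t (x, v)) \<in> conn X t (insert v U)" using xX by (intro conn_edge) auto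
    moreover have "(t (x, v), rep X t U (t (x, v))) \<in> conn X t (insert v U)"
      using conn_mono[OF subset_insertI[of U v], of X t] rep_conn[of "t (x, v)" X t U] by (rule subsetD)
    ultimately have "rep X t (insert v U) (rep X t U (t (x, v))) = rep X t (insert v U) x"
      by (metis conn_trans rep_eq_iff)
    moreover have "rep X t U (t (x, v)) \<noteq> x"
      using x(2) rep_conn conn_sym by metis
    ultimately show ?thesis using rack_closed[OF r xX v] by blast
  qed
  then have "card {x \<in> rep X t U ` X. (x, t (x, v)) \<notin> conn X t U}
    \<le> 2 * (card (rep X t U ` X) - card (rep X t (insert v U) ` (rep X t U ` X)))"
    using fin by (intro card_nontrivial_fibres) auto
  then show ?thesis using rep_image[OF r U, of "insert v U"] by (simp add: subset_insertI)
qed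


text \<open>The size bound on \<open>W\<close> allows \<open>k ^ 3\<close> for the union of the
  \<open>V i\<close> and \<open>k ^ 3\<close> for its extension. The index \<open>i\<close> may
  depend on \<open>v\<close>, which costs only a factor \<open>k\<close> per column.\<close>

definition framed :: "'a set \<Rightarrow> nat \<Rightarrow> ('a \<times> 'a \<Rightarrow> 'a) \<Rightarrow> 'a set \<Rightarrow> (nat \<Rightarrow> 'a set) \<Rightarrow> bool" where
  "framed X k t W V \<longleftrightarrow>
     W \<subseteq> X \<and> card W \<le> 2 * k ^ 3 \<and> (\<forall>i<k. V i \<subseteq> W \<and> card (V i) \<le> k\<^sup>2) \<and>
     (\<forall>v\<in>X - W. \<exists>i<k. (\<lambda>w. t (w, v)) ` V i \<subseteq> reach X t W \<and>
        card {x \<in> rep X t (V i) ` X. (x, t (x, v)) \<notin> conn X t (V i)} < 2 * k\<^sup>2)"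

text \<open>The potential is the number of merges, at most \<open>k ^ 4\<close>; gains of
  \<open>k\<^sup>2\<close> per element leave room for \<open>k\<^sup>2\<close> elements. Choosing
  inside \<open>Y\<close> allows disjoint sets to be taken one after another.\<close>

lemma saturated_exists:
  assumes fin: "finite X" and r: "rack X t" and Y: "Y \<subseteq> X"
    and k: "k > 0" "card X \<le> k ^ 4"
  shows "\<exists>V\<subseteq>Y. card V \<le> k\<^sup>2 \<and>
    (\<forall>v\<in>Y. card {x \<in> rep X t V ` X. (x, t (x, v)) \<notin> conn X t V} < 2 * k\<^sup>2)"
proof -
  define \<phi> where "\<phi> V = card X - card (rep X t V ` X)" for V
  have "finite Y" using Y fin by (rule finite_subset)
  from greedy[where B = "{}" and \<phi> = \<phi> and N = "card X" and k = "k\<^sup>2", OF this]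
  have "\<exists>V. V \<subseteq> Y \<and> card V * k\<^sup>2 \<le> card X \<and> (\<forall>v\<in>Y. \<phi> (insert v V) < \<phi> V + k\<^sup>2)"
    using k(1) by (simp add: \<phi>_def)
  then obtain V where V: "V \<subseteq> Y" "card V * k\<^sup>2 \<le> card X"
    and sat: "\<And>v. v \<in> Y \<Longrightarrow> \<phi> (insert v V) < \<phi> V + k\<^sup>2" by blast
  have "card V * k\<^sup>2 \<le> k ^ 4" using V(2) k(2) by simp
  also have "\<dots> = k\<^sup>2 * k\<^sup>2" by (simp flip: power_add)
  finally have "card V \<le> k\<^sup>2" using k(1) mult_le_cancel2[of "card V" "k\<^sup>2" "k\<^sup>2"] by simp
  moreover have "card {x \<in> rep X t V ` X. (x, t (x, v)) \<notin> conn X t V} < 2 * k\<^sup>2" if v: "v \<in> Y" for v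
  proof -
    have VX: "V \<subseteq> X" using V(1) Y by blast
    have "card (rep X t (insert v V) ` X) \<le> card (rep X t V ` X)"
      by (rule card_rep_antimono[OF fin r VX]) auto
    moreover have "card (rep X t V ` X) \<le> card X" by (rule card_image_le[OF fin])
    ultimately show ?thesis
      using card_moved_reps[OF fin r VX, of v] sat[OF v] v Y unfolding \<phi>_def by fastforce
  qed
  ultimately show ?thesis using V(1) by blast
qed

text \<open>The next set is taken from the complement of the earlier ones. Their saturation survives
  because it is claimed only outside the union, which grows.\<close>

lemma disjoint_saturated_exist:
  fixes m :: nat
  assumes fin: "finite X" and r: "rack X t" and k: "k > 0" "card X \<le> k ^ 4"
  shows "\<exists>V. (\<forall>i<m. V i \<subseteq> X \<and> card (V i) \<le> k\<^sup>2) \<and>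
    (\<forall>i<m. \<forall>j<m. i \<noteq> j \<longrightarrow> V i \<inter> V j = {}) \<and>
    (\<forall>i<m. \<forall>v\<in>X - (\<Union>i<m. V i).
       card {x \<in> rep X t (V i) ` X. (x, t (x, v)) \<notin> conn X t (V i)} < 2 * k\<^sup>2)"
proof (induction m)
  case 0
  then show ?case by simp
next
  case (Suc m)
  then obtain V where V: "\<forall>i<m. V i \<subseteq> X \<and> card (V i) \<le> k\<^sup>2"
    "\<forall>i<m. \<forall>j<m. i \<noteq> j \<longrightarrow> V i \<inter> V j = {}"
    "\<forall>i<m. \<forall>v\<in>X - (\<Union>i<m. V i).
       card {x \<in> rep X t (V i) ` X. (x, t (x, v)) \<notin> conn X t (V i)} < 2 * k\<^sup>2"
    by (elim exE conjE)
  have "X - (\<Union>i<m. V i) \<subseteq> X" by blast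
  from saturated_exists[OF fin r this k]
  obtain U where U: "U \<subseteq> X - (\<Union>i<m. V i)" "card U \<le> k\<^sup>2"
    "\<forall>v\<in>X - (\<Union>i<m. V i).
       card {x \<in> rep X t U ` X. (x, t (x, v)) \<notin> conn X t U} < 2 * k\<^sup>2"
    by (elim exE conjE)
  show ?case
  proof (intro exI[of _ "V(m := U)"] conjI allI impI ballI)
    fix i assume i: "i < Suc m"
    show "(V(m := U)) i \<subseteq> X" "card ((V(m := U)) i) \<le> k\<^sup>2"
      using i V(1) U(1,2) by (auto simp: less_Suc_eq)
    show "(V(m := U)) i \<inter> (V(m := U)) j = {}" if "j < Suc m" "i \<noteq> j" for j
      using i that V(2) U(1) by (auto simp: less_Suc_eq)
    show "card {x \<in> rep X t ((V(m := U)) i) ` X. (x, t (x, v)) \<notin> conn X t ((V(m := U)) i)} < 2 * k\<^sup>2"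
      if v: "v \<in> X - (\<Union>i<Suc m. (V(m := U)) i)" for v
    proof -
      have "v \<in> X - (\<Union>i<m. V i)" using v by (auto simp: less_Suc_eq split: if_splits)
      then show ?thesis using V(3) U(3) i by (cases "i = m") (simp_all add: less_Suc_eq)
    qed
  qed
qed

text \<open>Pigeonhole: if the column of \<open>v\<close> sent some point of every
  \<open>V i\<close> out of reach of \<open>W\<close>, adding \<open>v\<close> to \<open>W\<close>
  would bring \<open>k\<close> new points into reach, against the greedy choice of
  \<open>W\<close>.\<close>

lemma framed_exists:
  assumes fin: "finite X" and r: "rack X t" and k: "k > 0" "card X \<le> k ^ 4"
  shows "\<exists>W V. framed X k t W V"
proof -
  from disjoint_saturated_exist[OF fin r k, of k]
  obtain V where V': "\<forall>i<k. V i \<subseteq> X \<and> card (V i) \<le> k\<^sup>2"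
    and disj: "\<forall>i<k. \<forall>j<k. i \<noteq> j \<longrightarrow> V i \<inter> V j = {}"
    and sat: "\<forall>i<k. \<forall>v\<in>X - (\<Union>i<k. V i).
       card {x \<in> rep X t (V i) ` X. (x, t (x, v)) \<notin> conn X t (V i)} < 2 * k\<^sup>2"
    by (elim exE conjE)
  have V: "V i \<subseteq> X" "card (V i) \<le> k\<^sup>2" if "i < k" for i using V' that by auto
  define W0 where "W0 = (\<Union>i<k. V i)"
  have W0: "W0 \<subseteq> X" "finite W0" using V(1) fin finite_subset[of W0 X] by (auto simp: W0_def)
  have "card W0 \<le> (\<Sum>i<k. card (V i))" unfolding W0_def by (rule card_UN_le) simp
  also have "\<dots> \<le> (\<Sum>i<k. k\<^sup>2)" by (rule sum_mono) (use V(2) in simp)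
  finally have cW0: "card W0 \<le> k ^ 3" by (simp add: power2_eq_square power3_eq_cube)
  \<comment> \<open>The potential is the number of points in reach, at most \<open>k ^ 4\<close>, so
    gains of \<open>k\<close> permit at most \<open>k ^ 3\<close> additions to
    \<open>W0\<close>.\<close>
  have "\<exists>W. W0 \<subseteq> W \<and> W \<subseteq> W0 \<union> X \<and> (card W - card W0) * k \<le> card X \<and>
    (\<forall>v\<in>X. card (reach X t (insert v W)) < card (reach X t W) + k)"
  proof (rule greedy[where \<phi> = "\<lambda>W. card (reach X t W)"])
    show "card (reach X t W) \<le> card X" if "W \<subseteq> W0 \<union> X" for W
      using that W0 by (intro card_mono[OF fin] reach_subset[OF r]) auto
  qed (use fin W0 k in auto)
  then obtain W where W: "W0 \<subseteq> W" "W \<subseteq> X" "(card W - card W0) * k \<le> card X"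
    and grow: "\<And>v. v \<in> X \<Longrightarrow> card (reach X t (insert v W)) < card (reach X t W) + k"
    using Un_absorb1[OF W0(1)] by auto
  have "k ^ 4 = k ^ 3 * k" by (simp add: power_numeral_reduce)
  then have "(card W - card W0) * k \<le> k ^ 3 * k" using W(3) k(2) by linarith
  then have "card W - card W0 \<le> k ^ 3" using k(1) by (simp only: mult_le_cancel2)
  with cW0 have cW: "card W \<le> 2 * k ^ 3" by simp
  have ex: "\<exists>i<k. (\<lambda>w. t (w, v)) ` V i \<subseteq> reach X t W" if v: "v \<in> X" for v
  proof (rule ccontr)
    assume "\<not> ?thesis"
    then have "\<forall>i\<in>{..<k}. \<exists>w. w \<in> V i \<and> t (w, v) \<notin> reach X t W" by blast
    then obtain w where w: "\<And>i. i < k \<Longrightarrow> w i \<in> V i \<and> t (w i, v) \<notin> reach X t W"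
      by (metis lessThan_iff)
    have wW: "w i \<in> W" "w i \<in> X" if "i < k" for i
      using w[OF that] that W V(1) by (auto simp: W0_def)
    \<comment> \<open>Columns are injective, and disjointness of the \<open>V i\<close> makes the
      \<open>w i\<close> distinct.\<close>
    have inj: "inj_on (\<lambda>i. t (w i, v)) {..<k}"
    proof (rule inj_onI)
      fix i j assume ij: "i \<in> {..<k}" "j \<in> {..<k}" "t (w i, v) = t (w j, v)"
      then have "w i = w j" using rack_inj[OF r] wW v by blast
      then show "i = j" using disj w[of i] w[of j] ij by fastforce
    qed
    have "(\<lambda>i. t (w i, v)) ` {..<k} \<subseteq> reach X t (insert v W) - reach X t W"
    proof (rule image_subsetI)
      fix i assume "i \<in> {..<k}"
      then have "(w i, t (w i, v)) \<in> conn X t (insert v W)" "w i \<in> insert v W"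
        using wW by (auto intro: conn_edge)
      then show "t (w i, v) \<in> reach X t (insert v W) - reach X t W"
        using w \<open>i \<in> {..<k}\<close> unfolding reach_def by blast
    qed
    moreover have finR: "finite (reach X t (insert v W))"
      using finite_subset[OF reach_subset[OF r] fin] W v by simp
    ultimately have "card {..<k} \<le> card (reach X t (insert v W) - reach X t W)"
      using inj by (intro card_inj_on_le) auto
    also have "\<dots> = card (reach X t (insert v W)) - card (reach X t W)"
      using finR reach_mono[of W "insert v W" X t]
      by (intro card_Diff_subset) (auto intro: finite_subset)
    finally show False using grow[OF v] k by simp
  qed
  have "framed X k t W V"
    unfolding framed_def
  proof (intro conjI allI impI ballI)
    fix v assume v: "v \<in> X - W"
    obtain i where i: "i < k" "(\<lambda>w. t (w, v)) ` V i \<subseteq> reach X t W" using ex[of v] v by blast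
    moreover have "v \<in> X - (\<Union>i<k. V i)" using v W(1) by (auto simp: W0_def)
    ultimately show "\<exists>i<k. (\<lambda>w. t (w, v)) ` V i \<subseteq> reach X t W \<and>
        card {x \<in> rep X t (V i) ` X. (x, t (x, v)) \<notin> conn X t (V i)} < 2 * k\<^sup>2"
      using sat by blast
  qed (use W cW V(2) in \<open>auto simp: W0_def\<close>)
  then show ?thesis by blast
qed

section \<open>Counting the possible columns\<close>

lemma card_UN_bound:
  "finite I \<Longrightarrow> (\<And>i. i \<in> I \<Longrightarrow> card (A i) \<le> b) \<Longrightarrow> card (\<Union>i\<in>I. A i) \<le> card I * b"
  using order_trans[OF card_UN_le[of I A] sum_bounded_above[of I "\<lambda>i. card (A i)" b]] by simp

lemma exists_list_of_length:
  assumes "finite B" "B \<noteq> {}" "card B \<le> l"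
  shows "\<exists>xs. set xs = B \<and> length xs = l"
proof -
  obtain ys where ys: "set ys = B" "length ys = card B"
    using finite_distinct_list[OF assms(1)] distinct_card by metis
  obtain b where "b \<in> B" using assms(2) by blast
  then have "set (ys @ replicate (l - card B) b) = B" "length (ys @ replicate (l - card B) b) = l"
    using ys assms(3) by (auto simp: set_replicate_conv_if)
  then show ?thesis by blast
qed

text \<open>The count is the product of the component sizes. Each size \<open>m\<close> satisfies
  \<open>m \<le> 2 ^ (m - 1)\<close>, and the exponents add up to the number of points minus the
  number of components.\<close>

lemma card_transversals:
  assumes fin: "finite X" and r: "rack X t" and U: "U \<subseteq> X"
  shows "card (\<Pi>\<^sub>E x\<in>rep X t U ` X. conn X t U `` {x}) \<le> 2 ^ (card X - card (rep X t U ` X))"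
proof -
  define R where "R = rep X t U ` X"
  define C where "C x = conn X t U `` {x}" for x
  have RX: "R \<subseteq> X" using rep_in[OF r U] by (auto simp: R_def)
  have finR: "finite R" using fin by (simp add: R_def)
  have CX: "C x \<subseteq> X" if "x \<in> R" for x
    using that RX conn_closed[OF r U] by (auto simp: C_def)
  have finC: "finite (C x)" if "x \<in> R" for x using CX[OF that] fin finite_subset by blast
  have pos: "card (C x) > 0" if "x \<in> R" for x
    using finC[OF that] conn_refl[of x X t U] by (auto simp: C_def card_gt_0_iff)
  have repR: "rep X t U x = x" if "x \<in> R" for x
    using that rep_eq_iff[of X t U] rep_conn[of _ X t U] conn_sym by (fastforce simp: R_def)
  have "X = (\<Union>x\<in>R. C x)"
    using CX rep_conn[of _ X t U] conn_sym by (fastforce simp: R_def C_def)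
  moreover have "C x \<inter> C y = {}" if "x \<in> R" "y \<in> R" "x \<noteq> y" for x y
    using that repR rep_eq_iff[of X t U] unfolding C_def by (metis Image_singleton_iff disjoint_iff)
  ultimately have "card X = (\<Sum>x\<in>R. card (C x))"
    using card_UN_disjoint[OF finR, of C] finC by simp
  also have "\<dots> = (\<Sum>x\<in>R. (card (C x) - 1) + 1)" using pos by (intro sum.cong) auto
  also have "\<dots> = (\<Sum>x\<in>R. card (C x) - 1) + card R" by (simp only: sum.distrib) simp
  finally have s: "(\<Sum>x\<in>R. card (C x) - 1) = card X - card R" by linarith
  have "card (\<Pi>\<^sub>E x\<in>R. C x) = (\<Prod>x\<in>R. card (C x))" by (rule card_PiE[OF finR])
  also have "\<dots> \<le> (\<Prod>x\<in>R. 2 ^ (card (C x) - 1))"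
  proof (rule prod_mono, intro conjI)
    fix x assume "x \<in> R"
    then show "card (C x) \<le> 2 ^ (card (C x) - 1)"
      using pos[of x] less_exp[of "card (C x) - 1"] by linarith
  qed simp
  also have "\<dots> = 2 ^ (card X - card R)" unfolding s[symmetric] by (rule power_sum[symmetric])
  finally show ?thesis by (simp add: R_def C_def)
qed

text \<open>Both the rack \<open>s\<close> and the index \<open>v\<close> vary, so that one bound
  covers every rack sharing with \<open>t\<close> the columns of \<open>W\<close>.\<close>

definition columns ::
  "'a set \<Rightarrow> nat \<Rightarrow> ('a \<times> 'a \<Rightarrow> 'a) \<Rightarrow> 'a set \<Rightarrow> 'a set \<Rightarrow> ('a \<Rightarrow> 'a) set" where
  "columns X k t W V = {f. \<exists>s v. f = (\<lambda>x\<in>X. s (x, v)) \<and> rack X s \<and> v \<in> X \<and>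
     (\<forall>x\<in>X. \<forall>u\<in>W. s (x, u) = t (x, u)) \<and> (\<lambda>w. s (w, v)) ` V \<subseteq> reach X s W \<and>
     card {x \<in> rep X s V ` X. (x, s (x, v)) \<notin> conn X s V} < 2 * k\<^sup>2}"

text \<open>As \<open>V \<subseteq> W\<close>, the components and representatives of
  \<open>V\<close> are the same for \<open>s\<close> and \<open>t\<close>, so the moved
  representatives can be described by \<open>f\<close> and \<open>t\<close> without the hidden
  \<open>s\<close>.\<close>

lemma columnsE:
  assumes "f \<in> columns X k t W V" "V \<subseteq> W" "W \<subseteq> X" "rack X t"
  obtains s v where "rack X s" "v \<in> X" "\<And>x. x \<in> X \<Longrightarrow> f x = s (x, v)"
    "\<And>x u. x \<in> X \<Longrightarrow> u \<in> W \<Longrightarrow> s (x, u) = t (x, u)"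
    "\<And>w. w \<in> V \<Longrightarrow> s (w, v) \<in> reach X s W"
    "f \<in> X \<rightarrow>\<^sub>E X" "rep X s V = rep X t V"
    "card {x \<in> rep X t V ` X. (x, f x) \<notin> conn X t V} < 2 * k\<^sup>2"
proof -
  obtain s v where f: "f = (\<lambda>x\<in>X. s (x, v))" and s: "rack X s" "v \<in> X"
    "\<forall>x\<in>X. \<forall>u\<in>W. s (x, u) = t (x, u)" "(\<lambda>w. s (w, v)) ` V \<subseteq> reach X s W"
    "card {x \<in> rep X s V ` X. (x, s (x, v)) \<notin> conn X s V} < 2 * k\<^sup>2"
    using assms(1) unfolding columns_def by blast
  have rc: "rep X s V = rep X t V" "conn X s V = conn X t V"
    using s(3) assms(2) by (auto intro!: rep_cong conn_cong)
  have "{x \<in> rep X t V ` X. (x, f x) \<notin> conn X t V} = {x \<in> rep X s V ` X. (x, s (x, v)) \<notin> conn X s V}"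
    using rep_in[OF assms(4), of V] assms(2,3) unfolding rc f by auto
  with s(5) have "card {x \<in> rep X t V ` X. (x, f x) \<notin> conn X t V} < 2 * k\<^sup>2" by simp
  then show thesis
    using s f rc rack_closed[OF s(1)] by (intro that[OF s(1,2)]) auto
qed

text \<open>A column is encoded by the list of its values at exceptional points and a choice from each
  component; a point \<open>x0\<close> is thrown in to make the exceptional set nonempty, so that the list can
  be padded to a fixed length.\<close>

lemma card_columns:
  assumes fin: "finite X" and r: "rack X t" and V: "V \<subseteq> W" "W \<subseteq> X" "card V \<le> k\<^sup>2"
  shows "card (columns X k t W V) \<le> card X ^ (6 * k\<^sup>2) * 2 ^ (card X - card (rep X t V ` X))"
proof -
  define R where "R = rep X t V ` X"
  have VX: "V \<subseteq> X" using V by blast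
  have RX: "R \<subseteq> X" using rep_in[OF r VX] by (auto simp: R_def)
  obtain x0 where x0: "x0 \<in> X" using r by (auto simp: rack_def)
  define E where "E f = insert x0 (V \<union> {x \<in> R. (x, f x) \<notin> conn X t V})" for f
  define A where "A = {xs. set xs \<subseteq> X \<times> X \<and> length xs = 3 * k\<^sup>2}"
  define T where "T = (\<Pi>\<^sub>E x\<in>R. conn X t V `` {x})"
  have "\<exists>xs. set xs = (\<lambda>x. (x, f x)) ` E f \<and> length xs = 3 * k\<^sup>2"
    if "f \<in> columns X k t W V" for f
  proof (rule exists_list_of_length)
    have finE: "finite (E f)" using finite_subset[OF VX fin] finite_subset[OF RX fin] by (simp add: E_def)
    then show "finite ((\<lambda>x. (x, f x)) ` E f)" by simp
    have "card {x \<in> R. (x, f x) \<notin> conn X t V} < 2 * k\<^sup>2"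
      unfolding R_def by (rule columnsE[OF that V(1,2) r])
    \<comment> \<open>\<open>V\<close> gives at most \<open>k\<^sup>2\<close> points and the moved
      representatives fewer than \<open>2 * k\<^sup>2\<close>; strictness leaves room for
      \<open>x0\<close>.\<close>
    moreover have "card (E f) \<le> Suc (card V + card {x \<in> R. (x, f x) \<notin> conn X t V})"
      using finE card_Un_le[of V "{x \<in> R. (x, f x) \<notin> conn X t V}"] by (auto simp: E_def card_insert_if)
    ultimately have "card (E f) \<le> 3 * k\<^sup>2" using V(3) by linarith
    then show "card ((\<lambda>x. (x, f x)) ` E f) \<le> 3 * k\<^sup>2" using card_image_le[OF finE] order_trans by blast
  qed (simp add: E_def)
  then obtain zs where zs: "\<And>f. f \<in> columns X k t W V \<Longrightarrow> set (zs f) = (\<lambda>x. (x, f x)) ` E f"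
    "\<And>f. f \<in> columns X k t W V \<Longrightarrow> length (zs f) = 3 * k\<^sup>2" by metis
  \<comment> \<open>The value at a moved representative is in the list; the default \<open>x\<close>
    there keeps the second entry in \<open>T\<close>.\<close>
  define D where "D f = (zs f, \<lambda>x\<in>R. if (x, f x) \<in> conn X t V then f x else x)" for f
  have "D ` columns X k t W V \<subseteq> A \<times> T"
  proof (rule image_subsetI)
    fix f assume f: "f \<in> columns X k t W V"
    have fX: "f x \<in> X" if "x \<in> X" for x
      by (rule columnsE[OF f V(1,2) r]) (rule PiE_mem[OF _ that])
    have "E f \<subseteq> X" using x0 VX RX by (auto simp: E_def)
    then have "zs f \<in> A" using fX by (auto simp: A_def zs[OF f])
    moreover have "(\<lambda>x\<in>R. if (x, f x) \<in> conn X t V then f x else x) \<in> T"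
      by (auto simp: T_def conn_refl)
    ultimately show "D f \<in> A \<times> T" by (simp add: D_def)
  qed
  moreover have "inj_on D (columns X k t W V)"
  proof (rule inj_onI)
    fix f g assume f: "f \<in> columns X k t W V" and g: "g \<in> columns X k t W V" and eq: "D f = D g"
    obtain s v where s: "rack X s" "v \<in> X" "\<And>x. x \<in> X \<Longrightarrow> f x = s (x, v)"
      "\<And>x u. x \<in> X \<Longrightarrow> u \<in> W \<Longrightarrow> s (x, u) = t (x, u)"
      "\<And>w. w \<in> V \<Longrightarrow> s (w, v) \<in> reach X s W" "f \<in> X \<rightarrow>\<^sub>E X" "rep X s V = rep X t V"
      "card {x \<in> rep X t V ` X. (x, f x) \<notin> conn X t V} < 2 * k\<^sup>2"
      by (rule columnsE[OF f V(1,2) r]) blast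
    obtain s' v' where s': "rack X s'" "v' \<in> X" "\<And>x. x \<in> X \<Longrightarrow> g x = s' (x, v')"
      "\<And>x u. x \<in> X \<Longrightarrow> u \<in> W \<Longrightarrow> s' (x, u) = t (x, u)" "g \<in> X \<rightarrow>\<^sub>E X" "rep X s' V = rep X t V"
      "card {x \<in> rep X t V ` X. (x, g x) \<notin> conn X t V} < 2 * k\<^sup>2"
      by (rule columnsE[OF g V(1,2) r]) blast
    \<comment> \<open>The lists record points along with values, so their equality forces agreement
      on both exceptional sets.\<close>
    have "(\<lambda>x. (x, f x)) ` E f = (\<lambda>x. (x, g x)) ` E g"
      using eq zs(1)[OF f] zs(1)[OF g] by (simp add: D_def)
    then have E: "f x = g x" if "x \<in> E f \<union> E g" for x using that by blast
    have onR: "f x = g x" if x: "x \<in> R" for x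
    proof (cases "x \<in> E f \<union> E g")
      case False
      then have "(x, f x) \<in> conn X t V" "(x, g x) \<in> conn X t V" using x by (auto simp: E_def)
      moreover have "snd (D f) x = snd (D g) x" using eq by simp
      ultimately show ?thesis using x by (simp add: D_def)
    qed (rule E)
    show "f = g"
    proof (rule PiE_ext[OF s(6) s'(5)])
      fix x assume x: "x \<in> X"
      have "s (x, v) = s' (x, v')"
      proof (rule column_determined[OF s(1) s'(1) V(1,2) _ s(2) s'(2) s(5) _ _ x])
        show "s (w, v) = s' (w, v')" if "w \<in> V" for w
          using E[of w] that VX s(3) s'(3) by (auto simp: E_def)
        show "s (y, v) = s' (y, v')" if "y \<in> rep X s V ` X" for y
        proof -
          have "y \<in> R" "y \<in> X" using that RX s(7) by (auto simp: R_def)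
          then show ?thesis using onR s(3) s'(3) by metis
        qed
      qed (use s(4) s'(4) in auto)
      then show "f x = g x" using x s(3) s'(3) by simp
    qed
  qed
  moreover have "finite A" unfolding A_def using fin by (intro finite_lists_length_eq) auto
  moreover have "finite T"
    unfolding T_def using fin finite_subset[OF RX fin] RX conn_closed[OF r VX]
    by (intro finite_PiE) (auto intro: finite_subset[of _ X])
  ultimately have "card (columns X k t W V) \<le> card (A \<times> T)" by (intro card_inj_on_le) auto
  also have "\<dots> = card A * card T" by (rule card_cartesian_product)
  also have "\<dots> \<le> card X ^ (6 * k\<^sup>2) * 2 ^ (card X - card R)"
  proof (rule mult_le_mono)
    have "card A = card (X \<times> X) ^ (3 * k\<^sup>2)" unfolding A_def using fin by (intro card_lists_length_eq) auto
    then show "card A \<le> card X ^ (6 * k\<^sup>2)"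
      by (simp add: card_cartesian_product power_mult_distrib flip: power_add)
    show "card T \<le> 2 ^ (card X - card R)"
      unfolding T_def R_def by (rule card_transversals[OF fin r VX])
  qed
  finally show ?thesis by (simp add: R_def)
qed

section \<open>Upper bound for the number of racks\<close>

lemma mult_diff_le_quarter_square: "c * (n - c) \<le> n\<^sup>2 div 4" for c n :: nat
proof (cases "c \<le> n")
  case True
  then obtain d where n: "n = c + d" using le_Suc_ex by blast
  have "0 \<le> (int c - int d)\<^sup>2" by simp
  then have "4 * (int c * int d) \<le> (int c + int d)\<^sup>2" by (simp add: power2_eq_square algebra_simps)
  then have "4 * (c * d) \<le> (c + d)\<^sup>2"
    by (metis (mono_tags) of_nat_add of_nat_le_iff of_nat_mult of_nat_numeral of_nat_power)
  then show ?thesis by (simp add: n)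
qed simp

definition framed_racks ::
  "'a set \<Rightarrow> nat \<Rightarrow> 'a set \<Rightarrow> (nat \<Rightarrow> 'a set) \<Rightarrow> ('a \<times> 'a \<Rightarrow> 'a) \<Rightarrow> ('a \<times> 'a \<Rightarrow> 'a) set" where
  "framed_racks X k W V g = {t \<in> X \<times> X \<rightarrow>\<^sub>E X. rack X t \<and> framed X k t W V \<and> restrict t (X \<times> W) = g}"

text \<open>These racks share the columns of \<open>W\<close>, hence its components, and each is
  determined by its columns at the representatives in \<open>R\<close>. Each such column outside
  \<open>W\<close> comes from \<open>S\<close>, of size at most \<open>b * 2 ^ (n - card R)\<close>,
  and \<open>card R * (n - card R)\<close> is at most a quarter of \<open>n\<close> squared.\<close>

lemma card_framed_racks:
  assumes fin: "finite X" and X: "X \<noteq> {}" and k: "k > 0"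
  shows "card (framed_racks X k W V g)
    \<le> (k * card X ^ (6 * k\<^sup>2)) ^ card X * 2 ^ ((card X)\<^sup>2 div 4)"
proof (cases "framed_racks X k W V g = {}")
  case False
  define n where "n = card X"
  have n: "n > 0" using fin X by (simp add: n_def card_gt_0_iff)
  \<comment> \<open>Any member serves as reference: the components and representatives of
    \<open>W\<close> read off from it are common to all.\<close>
  obtain t0 where t0: "rack X t0" "framed X k t0 W V" "restrict t0 (X \<times> W) = g"
    using False by (auto simp: framed_racks_def)
  have W: "W \<subseteq> X" and V: "\<And>i. i < k \<Longrightarrow> V i \<subseteq> W" "\<And>i. i < k \<Longrightarrow> card (V i) \<le> k\<^sup>2"
    using t0(2) by (auto simp: framed_def)
  define R where "R = rep X t0 W ` X"
  define S where "S = (\<Union>i<k. columns X k t0 W (V i))"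
  define b where "b = k * n ^ (6 * k\<^sup>2)"
  have finR: "finite R" using fin by (simp add: R_def)
  have ag: "t (x, u) = t0 (x, u)"
    if "t \<in> framed_racks X k W V g" "x \<in> X" "u \<in> W" for t x u
  proof -
    have "restrict t (X \<times> W) (x, u) = restrict t0 (X \<times> W) (x, u)"
      using that(1) t0(3) by (simp add: framed_racks_def)
    then show ?thesis using that(2,3) by simp
  qed
  have "card S \<le> card {..<k} * (n ^ (6 * k\<^sup>2) * 2 ^ (n - card R))"
    unfolding S_def
  proof (rule card_UN_bound)
    fix i assume i: "i \<in> {..<k}"
    have "card (columns X k t0 W (V i)) \<le> n ^ (6 * k\<^sup>2) * 2 ^ (n - card (rep X t0 (V i) ` X))"
      unfolding n_def using card_columns[OF fin t0(1) V(1) W V(2)] i by simp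
    \<comment> \<open>As \<open>V i\<close> lies in \<open>W\<close>, it has at least as many
      components as \<open>W\<close>.\<close>
    also have "\<dots> \<le> n ^ (6 * k\<^sup>2) * 2 ^ (n - card R)"
      using card_rep_antimono[OF fin t0(1) _ V(1), of i] V(1)[of i] W i
      by (intro mult_left_mono power_increasing diff_le_mono2) (auto simp: R_def)
    finally show "card (columns X k t0 W (V i)) \<le> n ^ (6 * k\<^sup>2) * 2 ^ (n - card R)" .
  qed simp
  then have cS: "card S \<le> b * 2 ^ (n - card R)" by (simp add: b_def mult.assoc)
  have b: "b \<ge> 1" using n k by (simp add: b_def Suc_le_eq)
  \<comment> \<open>The columns of \<open>W\<close> are fixed by \<open>g\<close>, so only those of
    the other representatives are recorded.\<close>
  define \<Psi> where "\<Psi> t = (\<lambda>v\<in>R - W. \<lambda>x\<in>X. t (x, v))" for t :: "'a \<times> 'a \<Rightarrow> 'a"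
  have "\<Psi> ` framed_racks X k W V g \<subseteq> (R - W) \<rightarrow>\<^sub>E S"
  proof (rule image_subsetI)
    fix t assume t: "t \<in> framed_racks X k W V g"
    have "(\<lambda>x\<in>X. t (x, v)) \<in> S" if v: "v \<in> R - W" for v
    proof -
      have vX: "v \<in> X - W" using v rep_in[OF t0(1) W] by (auto simp: R_def)
      then obtain i where i: "i < k" "(\<lambda>w. t (w, v)) ` V i \<subseteq> reach X t W"
        "card {x \<in> rep X t (V i) ` X. (x, t (x, v)) \<notin> conn X t (V i)} < 2 * k\<^sup>2"
        using t unfolding framed_racks_def framed_def by blast
      have "rack X t" using t by (simp add: framed_racks_def)
      then have "(\<lambda>x\<in>X. t (x, v)) \<in> columns X k t0 W (V i)"
        unfolding columns_def using i(2,3) ag[OF t] vX by blast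
      then show ?thesis using i(1) by (auto simp: S_def)
    qed
    then show "\<Psi> t \<in> (R - W) \<rightarrow>\<^sub>E S" by (simp add: \<Psi>_def)
  qed
  moreover have "inj_on \<Psi> (framed_racks X k W V g)"
  proof (rule inj_onI)
    fix t s assume t: "t \<in> framed_racks X k W V g" and s: "s \<in> framed_racks X k W V g"
      and eq: "\<Psi> t = \<Psi> s"
    have rt: "rack X t" "t \<in> X \<times> X \<rightarrow>\<^sub>E X" and rs: "rack X s" "s \<in> X \<times> X \<rightarrow>\<^sub>E X"
      using s t by (auto simp: framed_racks_def)
    have agW: "t (x, u) = s (x, u)" if "x \<in> X" "u \<in> W" for x u
      using ag[OF t that] ag[OF s that] by simp
    have agR: "t (x, v) = s (x, v)" if "x \<in> X" "v \<in> R" for x v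
    proof (cases "v \<in> W")
      case False
      then have "\<Psi> t v x = \<Psi> s v x" "v \<in> R - W" using eq that by auto
      then show ?thesis using that by (simp add: \<Psi>_def)
    qed (use agW that in blast)
    show "t = s"
    proof (rule PiE_ext[OF rt(2) rs(2)])
      fix p assume "p \<in> X \<times> X"
      then obtain x y where p: "p = (x, y)" "x \<in> X" "y \<in> X" by blast
      define v where "v = rep X t0 W y"
      have v: "v \<in> R" "v \<in> X" using p rep_in[OF t0(1) W] by (auto simp: v_def R_def)
      have "(v, y) \<in> conn X t0 W" unfolding v_def by (rule conn_sym[OF rep_conn])
      also have "conn X t0 W = conn X t W" using ag[OF t] by (intro conn_cong) simp
      finally have "(v, y) \<in> conn X t W" .
      from columns_agree[OF rt(1) rs(1) W agW v(2) this agR[OF _ v(1)] p(2)]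
      show "t p = s p" using p(1) by simp
    qed
  qed
  moreover have "finite ((R - W) \<rightarrow>\<^sub>E S)"
  proof (rule finite_PiE)
    have "S \<subseteq> X \<rightarrow>\<^sub>E X"
      unfolding S_def columns_def using rack_closed by fastforce
    then show "finite S" by (rule finite_subset) (intro finite_PiE fin)
  qed (use finR in auto)
  ultimately have "card (framed_racks X k W V g) \<le> card ((R - W) \<rightarrow>\<^sub>E S)" by (intro card_inj_on_le)
  also have "\<dots> = card S ^ card (R - W)" using finR by (simp add: card_PiE)
  also have "\<dots> \<le> (b * 2 ^ (n - card R)) ^ card (R - W)" by (rule power_mono[OF cS]) simp
  also have "\<dots> \<le> (b * 2 ^ (n - card R)) ^ card R"
    using b finR by (intro power_increasing card_mono) (auto simp: Suc_le_eq)
  also have "\<dots> = b ^ card R * 2 ^ (card R * (n - card R))"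
    by (simp add: power_mult_distrib mult.commute flip: power_mult)
  also have "\<dots> \<le> b ^ n * 2 ^ (n\<^sup>2 div 4)"
  proof (intro mult_le_mono power_increasing)
    show "card R \<le> n" unfolding R_def n_def by (rule card_image_le[OF fin])
    show "card R * (n - card R) \<le> n\<^sup>2 div 4" by (rule mult_diff_le_quarter_square)
  qed (use b in auto)
  finally show ?thesis by (simp add: b_def n_def)
qed simp

text \<open>The factors count, in this order, the choices for \<open>W\<close>, for the family
  \<open>V\<close>, for the columns of \<open>W\<close>, and for a rack with these data.\<close>

lemma card_racks_le:
  assumes n: "n > 0" and k: "k > 0" "n \<le> k ^ 4"
  shows "card (racks n) \<le> 2 ^ n * (2 ^ n) ^ k *
    (n ^ (n * (2 * k ^ 3)) * ((k * n ^ (6 * k\<^sup>2)) ^ n * 2 ^ (n\<^sup>2 div 4)))"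
proof -
  define X where "X = {1..n}"
  have X: "finite X" "card X = n" "X \<noteq> {}" using n by (auto simp: X_def)
  define b where "b = (k * n ^ (6 * k\<^sup>2)) ^ n * 2 ^ (n\<^sup>2 div 4)"
  define Fr where "Fr = {W. W \<subseteq> X \<and> card W \<le> 2 * k ^ 3} \<times> ({..<k} \<rightarrow>\<^sub>E Pow X)"
  have finF: "finite Fr" unfolding Fr_def using X(1) by (intro finite_cartesian_product finite_PiE) auto
  have "racks n \<subseteq> (\<Union>(W, V)\<in>Fr. \<Union>g\<in>X \<times> W \<rightarrow>\<^sub>E X. framed_racks X k W V g)"
  proof
    fix t assume "t \<in> racks n"
    then have t: "t \<in> X \<times> X \<rightarrow>\<^sub>E X" "rack X t" by (auto simp: racks_def X_def)
    obtain W V where WV: "framed X k t W V" using framed_exists[OF X(1) t(2) k(1)] k(2) X(2) by blast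
    \<comment> \<open>Cutting \<open>V\<close> down to its first \<open>k\<close> sets places it in
      a finite function space.\<close>
    define V' where "V' = restrict V {..<k}"
    have fr: "framed X k t W V'" using WV by (simp add: framed_def V'_def cong: conj_cong)
    then have "(W, V') \<in> Fr" by (auto simp: Fr_def V'_def framed_def)
    moreover have "restrict t (X \<times> W) \<in> X \<times> W \<rightarrow>\<^sub>E X"
      using t(1) fr by (auto simp: framed_def)
    moreover have "t \<in> framed_racks X k W V' (restrict t (X \<times> W))"
      using t fr by (simp add: framed_racks_def)
    ultimately show "t \<in> (\<Union>(W, V)\<in>Fr. \<Union>g\<in>X \<times> W \<rightarrow>\<^sub>E X. framed_racks X k W V g)" by blast
  qed
  moreover have "finite (\<Union>(W, V)\<in>Fr. \<Union>g\<in>X \<times> W \<rightarrow>\<^sub>E X. framed_racks X k W V g)"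
    by (rule finite_subset[of _ "X \<times> X \<rightarrow>\<^sub>E X"])
      (use X(1) in \<open>auto simp: framed_racks_def intro!: finite_PiE\<close>)
  ultimately have "card (racks n) \<le> card (\<Union>(W, V)\<in>Fr. \<Union>g\<in>X \<times> W \<rightarrow>\<^sub>E X. framed_racks X k W V g)"
    by (rule card_mono[rotated])
  also have "\<dots> \<le> card Fr * (n ^ (n * (2 * k ^ 3)) * b)"
  proof (rule card_UN_bound[OF finF])
    fix p assume "p \<in> Fr"
    then obtain W V where p: "p = (W, V)" "W \<subseteq> X" "card W \<le> 2 * k ^ 3" by (auto simp: Fr_def)
    have fW: "finite (X \<times> W)" using p(2) X(1) finite_subset by blast
    have "card (\<Union>g\<in>X \<times> W \<rightarrow>\<^sub>E X. framed_racks X k W V g) \<le> card (X \<times> W \<rightarrow>\<^sub>E X) * b"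
      using card_framed_racks[OF X(1,3) k(1), of W V] fW X(1,2)
      by (intro card_UN_bound finite_PiE) (auto simp: b_def)
    also have "card (X \<times> W \<rightarrow>\<^sub>E X) = n ^ (n * card W)"
      using fW X(2) by (simp add: card_PiE card_cartesian_product)
    also have "\<dots> * b \<le> n ^ (n * (2 * k ^ 3)) * b"
      using p(3) n by (intro mult_le_mono power_increasing) auto
    finally show "card (case p of (W, V) \<Rightarrow> \<Union>g\<in>X \<times> W \<rightarrow>\<^sub>E X. framed_racks X k W V g)
      \<le> n ^ (n * (2 * k ^ 3)) * b" by (simp add: p(1))
  qed
  also have "card Fr \<le> 2 ^ n * (2 ^ n) ^ k"
  proof -
    have "card {W. W \<subseteq> X \<and> card W \<le> 2 * k ^ 3} \<le> card (Pow X)" using X(1) by (intro card_mono) auto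
    then show ?thesis
      unfolding Fr_def using X by (simp add: card_cartesian_product card_PiE card_Pow)
  qed
  finally show ?thesis by (simp add: b_def)
qed

section \<open>Lower bound from commuting pair swaps\<close>

definition pair_swap :: "nat \<Rightarrow> nat" where
  "pair_swap x = (if odd x then Suc x else x - 1)"

text \<open>The pairs are \<open>{2 j + 1, 2 j + 2}\<close> for \<open>j < n div 2\<close>; if \<open>n\<close> is odd, then \<open>n\<close> itself
  is fixed by every column and has the identity as its column.\<close>

definition swap_rack :: "nat \<Rightarrow> (nat \<times> nat) set \<Rightarrow> nat \<times> nat \<Rightarrow> nat" where
  "swap_rack n A = (\<lambda>(x, y)\<in>{1..n} \<times> {1..n}.
     if ((y - 1) div 2, (x - 1) div 2) \<in> A then pair_swap x else x)"

text \<open>In the last clause the hypothesis rules out the point \<open>n\<close> for odd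
  \<open>n\<close>, whose partner would be \<open>n + 1\<close>.\<close>

lemma pair_swap:
  assumes "x \<ge> 1"
  shows "pair_swap (pair_swap x) = x" "(pair_swap x - 1) div 2 = (x - 1) div 2"
    "pair_swap x \<ge> 1" "pair_swap x \<noteq> x"
    "(x - 1) div 2 < n div 2 \<Longrightarrow> pair_swap x \<le> n"
  using assms unfolding pair_swap_def by (simp_all split: if_splits) presburger+

text \<open>Every column is an involution preserving each pair, so \<open>t (y, z)\<close> has the
  same column as \<open>y\<close>. The rack law thus says that two columns commute on the pair of
  \<open>x\<close>.\<close>

lemma swap_rack:
  assumes A: "A \<subseteq> {..<n div 2} \<times> {..<n div 2}" and n: "n > 0"
  shows "swap_rack n A \<in> racks n"
proof -
  define t where "t = swap_rack n A"
  define X where "X = {1..n}"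
  define p where "p x = (x - 1) div 2" for x :: nat
  have t: "t (x, y) = (if (p y, p x) \<in> A then pair_swap x else x)" if "x \<in> X" "y \<in> X" for x y
    using that by (simp add: t_def swap_rack_def X_def p_def)
  have sX: "pair_swap x \<in> X" if "x \<in> X" "(q, p x) \<in> A" for x q
  proof -
    have "p x < n div 2" using that(2) A by blast
    then show ?thesis using that(1) pair_swap(3)[of x] pair_swap(5)[of x n] by (simp add: X_def p_def)
  qed
  have tX: "t (x, y) \<in> X" if "x \<in> X" "y \<in> X" for x y
    using that sX t by simp
  have pt: "p (t (x, y)) = p x" if "x \<in> X" "y \<in> X" for x y
    using that pair_swap(2)[of x] by (simp add: t X_def p_def)
  have ss: "pair_swap (pair_swap x) = x" if "x \<in> X" for x
    using that pair_swap(1)[of x] by (simp add: X_def)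
  have tt: "t (t (x, y), y) = x" if "x \<in> X" "y \<in> X" for x y
  proof -
    have "t (t (x, y), y) = (if (p y, p x) \<in> A then pair_swap (t (x, y)) else t (x, y))"
      using t[OF tX[OF that] that(2)] pt[OF that] by simp
    then show ?thesis using t[OF that] ss[OF that(1)] by simp
  qed
  have "rack X t"
    unfolding rack_def
  proof (intro conjI ballI impI)
    show "X \<noteq> {}" using n by (simp add: X_def)
    show "t \<in> X \<times> X \<rightarrow> X" using tX by auto
  next
    fix y z assume "y \<in> X" "z \<in> X"
    then show "\<exists>x\<in>X. z = t (x, y)" using tt tX by metis
  next
    fix x y z assume "x \<in> X" "y \<in> X" "z \<in> X" "t (x, y) = t (z, y)"
    then show "x = z" using tt by metis
  next
    fix x y z assume x: "x \<in> X" and y: "y \<in> X" and z: "z \<in> X"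
    show "t (t (x, y), z) = t (t (x, z), t (y, z))"
      using t[OF tX[OF x y] z] t[OF tX[OF x z] tX[OF y z]] pt[OF x y] pt[OF x z] pt[OF y z]
        t[OF x y] t[OF x z] by simp
  qed
  moreover have "t \<in> X \<times> X \<rightarrow>\<^sub>E X"
    using tX by (auto simp: PiE_iff t_def swap_rack_def X_def extensional_def)
  ultimately show ?thesis by (simp add: racks_def t_def X_def)
qed

text \<open>The entry \<open>(i, j)\<close> of the bit matrix shows in whether the column of
  \<open>2 * i + 1\<close> moves \<open>2 * j + 1\<close>.\<close>

lemma inj_on_swap_rack: "inj_on (swap_rack n) (Pow ({..<n div 2} \<times> {..<n div 2}))"
proof (rule inj_onI)
  fix A B assume A: "A \<in> Pow ({..<n div 2} \<times> {..<n div 2})" and B: "B \<in> Pow ({..<n div 2} \<times> {..<n div 2})"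
    and eq: "swap_rack n A = swap_rack n B"
  have "(i, j) \<in> A \<longleftrightarrow> (i, j) \<in> B" if "i < n div 2" "j < n div 2" for i j
  proof -
    have "swap_rack n C (2 * j + 1, 2 * i + 1) = 2 * j + 1 \<longleftrightarrow> (i, j) \<notin> C" for C
      using that by (auto simp: swap_rack_def pair_swap_def)
    then show ?thesis using eq by metis
  qed
  then show "A = B" using A B by blast
qed

lemma card_racks_ge:
  assumes "n > 0"
  shows "2 ^ (n div 2)\<^sup>2 \<le> card (racks n)"
proof -
  have "card (Pow ({..<n div 2} \<times> {..<n div 2})) \<le> card (racks n)"
    using swap_rack[OF _ assms]
    by (intro card_inj_on_le[OF inj_on_swap_rack _ finite_racks]) auto
  then show ?thesis by (simp add: card_Pow card_cartesian_product power2_eq_square)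
qed

section \<open>Passing to isomorphism classes\<close>

text \<open>Every member of the class is a fixed rack \<open>t\<close> transported along a bijection
  of the ground set, and there are \<open>n ^ n\<close> self-maps in all.\<close>

lemma card_rack_class_le:
  assumes C: "C \<in> rack_classes n"
  shows "card C \<le> n ^ n"
proof -
  define X where "X = {1..n}"
  obtain t where t: "t \<in> racks n" "C = racks_iso_rel n `` {t}"
    using C unfolding rack_classes_def by (rule quotientE)
  \<comment> \<open>For maps that are not bijective the value carries no meaning, but the image only
    has to cover \<open>C\<close>.\<close>
  define tr where "tr \<phi> = (\<lambda>(x, y)\<in>X \<times> X. \<phi> (t (the_inv_into X \<phi> x, the_inv_into X \<phi> y)))" for \<phi>
  have "C \<subseteq> tr ` (X \<rightarrow>\<^sub>E X)"
  proof
    fix s assume "s \<in> C"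
    then have s: "s \<in> X \<times> X \<rightarrow>\<^sub>E X" "rack_isomorphic X t X s"
      using t(2) by (auto simp: racks_iso_rel_def racks_def X_def)
    obtain \<phi> where \<phi>: "bij_betw \<phi> X X" "\<And>x y. x \<in> X \<Longrightarrow> y \<in> X \<Longrightarrow> \<phi> (t (x, y)) = s (\<phi> x, \<phi> y)"
      using s(2) unfolding rack_isomorphic_def rack_iso_def rack_hom_def by blast
    define \<psi> where "\<psi> = restrict \<phi> X"
    have tX: "t (x, y) \<in> X" if "x \<in> X" "y \<in> X" for x y
      using t(1) that by (auto simp: racks_def X_def)
    have b: "bij_betw \<psi> X X" using \<phi>(1) bij_betw_cong[of X \<psi> \<phi> X] by (simp add: \<psi>_def)
    have h: "\<psi> (t (x, y)) = s (\<psi> x, \<psi> y)" if "x \<in> X" "y \<in> X" for x y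
      using \<phi>(2) that tX by (simp add: \<psi>_def)
    have "s = tr \<psi>"
    proof (rule ext)
      fix p
      show "s p = tr \<psi> p"
      proof (cases "p \<in> X \<times> X")
        case True
        then obtain x y where p: "p = (x, y)" "x \<in> X" "y \<in> X" by blast
        have "the_inv_into X \<psi> z \<in> X" "\<psi> (the_inv_into X \<psi> z) = z" if "z \<in> X" for z
          using that bij_betwE[OF bij_betw_the_inv_into[OF b]] f_the_inv_into_f_bij_betw[OF b] by auto
        then show ?thesis using p h by (simp add: tr_def)
      next
        case False
        then show ?thesis using PiE_arb[OF s(1)] by (simp add: tr_def restrict_def)
      qed
    qed
    moreover have "\<psi> \<in> X \<rightarrow>\<^sub>E X" using bij_betwE[OF b] by (auto simp: \<psi>_def)
    ultimately show "s \<in> tr ` (X \<rightarrow>\<^sub>E X)" by blast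
  qed
  then have "card C \<le> card (X \<rightarrow>\<^sub>E X)"
    by (rule surj_card_le[rotated]) (simp add: X_def finite_PiE)
  then show ?thesis by (simp add: card_PiE X_def)
qed

lemma card_racks_le_classes: "card (racks n) \<le> card (rack_classes n) * n ^ n"
proof -
  have "finite (rack_classes n)"
    unfolding rack_classes_def using finite_racks
    by (rule finite_quotient) (auto simp: racks_iso_rel_def)
  then have "card (\<Union>C\<in>rack_classes n. C) \<le> card (rack_classes n) * n ^ n"
    using card_rack_class_le by (rule card_UN_bound)
  moreover have "(\<Union>C\<in>rack_classes n. C) = racks n"
    using Union_quotient[OF equiv_racks_iso_rel, of n] by (simp add: rack_classes_def)
  ultimately show ?thesis by simp
qed

lemma card_rack_classes_le: "card (rack_classes n) \<le> card (racks n)"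
proof -
  have "rack_classes n = (\<lambda>t. racks_iso_rel n `` {t}) ` racks n"
    by (auto simp: rack_classes_def quotient_def)
  then show ?thesis using card_image_le[OF finite_racks] by simp
qed

section \<open>Asymptotic comparison\<close>

text \<open>The first term pays for dividing by \<open>n ^ n\<close>, the second for the rounding in
  \<open>n div 2\<close>.\<close>

lemma racks_lower_asymptotics:
  fixes \<epsilon> :: real
  assumes "\<epsilon> > 0"
  shows "\<forall>\<^sub>F n :: nat in sequentially.
    real n * log 2 (real n) + real n / 2 \<le> \<epsilon> * (real n)\<^sup>2"
  using assms by real_asymp

text \<open>The left side is the binary logarithm of the bound in \<open>card_racks_le\<close>
  without its last factor, with \<open>n powr (1/4) + 1\<close> for \<open>k\<close>. Its largest
  term has order \<open>n powr (7/4) * log 2 n\<close>.\<close>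

lemma racks_upper_asymptotics:
  fixes \<epsilon> :: real
  assumes "\<epsilon> > 0"
  shows "\<forall>\<^sub>F n :: nat in sequentially.
    real n + real n * (real n powr (1/4) + 1) + log 2 (real n) * (real n * (2 * (real n powr (1/4) + 1) ^ 3))
      + real n * (log 2 (real n powr (1/4) + 1) + log 2 (real n) * (6 * (real n powr (1/4) + 1)\<^sup>2))
    \<le> \<epsilon> * (real n)\<^sup>2"
  using assms by real_asymp

theorem theorem1p1:
  fixes \<epsilon> :: real
  assumes "\<epsilon> > 0"
  shows "\<forall>\<^sub>F n :: nat in sequentially.
           2 powr ((1/4 - \<epsilon>) * (real n)\<^sup>2) \<le> real (card (rack_classes n)) \<and>
           card (rack_classes n) \<le> card (racks n) \<and>
           real (card (racks n)) \<le> 2 powr ((1/4 + \<epsilon>) * (real n)\<^sup>2)"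
  using racks_lower_asymptotics[OF assms] racks_upper_asymptotics[OF assms] eventually_gt_at_top[of 0]
proof eventually_elim
  case (elim n)
  define L where "L = log 2 (real n)"
  have n: "real n > 0" "real n = 2 powr L" and L: "L \<ge> 0" using elim(3) by (auto simp: L_def)
  have nn: "real (n ^ m) = 2 powr (L * real m)" for m
    using n by (simp add: powr_powr[symmetric] powr_realpow)
  \<comment> \<open>The factor \<open>n ^ n\<close> is carried along so that
    \<open>card_racks_le_classes\<close> applies; it cancels at the end.\<close>
  have "2 powr ((1/4 - \<epsilon>) * (real n)\<^sup>2) * real (n ^ n) = 2 powr ((1/4 - \<epsilon>) * (real n)\<^sup>2 + real n * L)"
    unfolding nn by (simp add: powr_add mult.commute)
  also have "\<dots> \<le> 2 powr (real (n div 2))\<^sup>2"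
  proof -
    \<comment> \<open>Equality holds for odd \<open>n\<close>; the loss of \<open>n / 2\<close>
      after squaring is absorbed by \<open>elim(1)\<close>.\<close>
    have "(real n - 1) / 2 \<le> real (n div 2)" by (cases "even n") (auto elim!: evenE oddE)
    then have "((real n - 1) / 2)\<^sup>2 \<le> (real (n div 2))\<^sup>2" using elim(3) by (intro power_mono) auto
    moreover have "((real n - 1) / 2)\<^sup>2 = (real n)\<^sup>2 / 4 - real n / 2 + 1/4"
      by (simp add: power2_eq_square field_simps)
    ultimately show ?thesis using elim(1) by (simp add: L_def left_diff_distrib)
  qed
  also have "\<dots> = real (2 ^ (n div 2)\<^sup>2)" by (simp add: powr_realpow flip: of_nat_power)
  also have "\<dots> \<le> real (card (rack_classes n) * n ^ n)"
    using order_trans[OF card_racks_ge[OF elim(3)] card_racks_le_classes] by (rule of_nat_mono)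
  finally have lower: "2 powr ((1/4 - \<epsilon>) * (real n)\<^sup>2) \<le> real (card (rack_classes n))"
    using elim(3) by simp

  \<comment> \<open>Rounding the fourth root of \<open>n\<close> up gives
    \<open>n \<le> k ^ 4\<close>, while \<open>k \<le> r + 1\<close> keeps the exponent
    small.\<close>
  define r where "r = real n powr (1/4)"
  define k where "k = nat \<lceil>r\<rceil>"
  have r: "r > 0" using n by (simp add: r_def)
  then have k: "k > 0" "r \<le> real k" "real k \<le> r + 1" unfolding k_def by linarith+
  have "real n = r ^ 4" using n by (simp add: r_def powr_powr flip: powr_realpow)
  also have "\<dots> \<le> real k ^ 4" using r k by (intro power_mono) auto
  finally have nk: "n \<le> k ^ 4" by (simp flip: of_nat_power)
  have two: "real (2 ^ m) = 2 powr real m" for m by (simp add: powr_realpow)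
  \<comment> \<open>With \<open>k\<close> as a power of 2, all factors collect into one
    exponent.\<close>
  have kk: "real k = 2 powr log 2 (real k)" using k by simp
  have "real (card (racks n)) \<le> real (2 ^ n * (2 ^ n) ^ k *
    (n ^ (n * (2 * k ^ 3)) * ((k * n ^ (6 * k\<^sup>2)) ^ n * 2 ^ (n\<^sup>2 div 4))))"
    by (rule of_nat_mono[OF card_racks_le[OF elim(3) k(1) nk]])
  also have "\<dots> = real (2 ^ n) * real (2 ^ (n * k)) * (real (n ^ (n * (2 * k ^ 3)))
      * ((2 powr log 2 (real k) * real (n ^ (6 * k\<^sup>2))) ^ n * real (2 ^ (n\<^sup>2 div 4))))"
    using kk by (simp add: power_mult)
  also have "\<dots> = 2 powr (real n + real n * real k + L * (real n * (2 * real k ^ 3))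
      + real n * (log 2 (real k) + L * (6 * (real k)\<^sup>2)) + real (n\<^sup>2 div 4))"
    unfolding nn two
    by (simp add: powr_add powr_powr algebra_simps flip: powr_realpow)
  \<comment> \<open>The exponent is increasing in \<open>k\<close>, so \<open>r + 1\<close> may
    replace \<open>k\<close>.\<close>
  also have "\<dots> \<le> 2 powr (real n + real n * (r + 1) + L * (real n * (2 * (r + 1) ^ 3))
      + real n * (log 2 (r + 1) + L * (6 * (r + 1)\<^sup>2)) + (real n)\<^sup>2 / 4)"
  proof (intro powr_mono add_mono mult_left_mono power_mono)
    show "real (n\<^sup>2 div 4) \<le> (real n)\<^sup>2 / 4"
      using of_nat_mono[of "4 * (n\<^sup>2 div 4)" "n\<^sup>2", where ?'a = real] by simp
  qed (use k L r in auto)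
  also have "\<dots> \<le> 2 powr ((1/4 + \<epsilon>) * (real n)\<^sup>2)"
    using elim(2) by (simp add: r_def L_def algebra_simps)
  finally show ?case using lower card_rack_classes_le by blast
qed

end
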